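(* Let $p$ be a prime number, let $n \ge 1$, and let $m_i$ and $a_i$ be integers with $1 \leq m_i \leq p-1$ and $0 \leq a_i \leq p-1$ for each $i=1, 2, \ldots, n$. If $a_i \neq a_j$ whenever $i \neq j$, then we have the following congruence modulo $p$: $$\sum_{k=0}^{p-1} (a_1+k)^{m_1} \cdots (a_n+k)^{m_n} \equiv \begin{cases} 0, & \text{if } m_1+\cdots+m_n < p-1,\\ -n, & \text{if } m_1=m_2= \cdots =m_n=p-1,\\ J, & \text{otherwise}, \end{cases}$$ where, with $b_{i'}=a_{i'}-a_n$ for $i'=1, 2, \ldots, n-1$, $M_i=m_1+\cdots+m_n-i(p-1)$, and $t$ the integer such that $M_{t+1}<0 \leq M_t$, $$J=-\sum_{i=1}^t \;\; \sum_{\substack{j_1+\cdots+j_{n-1}=M_i \\ 0 \leq j_1 \leq m_1, \ldots, 0 \leq j_{n-1} \leq m_{n-1}}} \binom{m_1}{j_1} \cdots \binom{m_{n-1}}{j_{n-1}} b_1^{j_1} \cdots b_{n-1}^{j_{n-1}}.$$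
   Context: The inner sum in $J$ runs over integer tuples $(j_1,\ldots,j_{n-1})$; an empty sum is $0$, and for $n=1$ the empty tuple has sum $0$ and contributes the empty product $1$. *)

theory Defs
  imports "HOL-Number_Theory.Cong" "HOL-Library.FuncSet"
begin

text \<open>Families \<open>(m\<^sub>1, \<dots>, m\<^sub>n)\<close> and \<open>(a\<^sub>1, \<dots>, a\<^sub>n)\<close> are functions on \<^typ>\<open>nat\<close> of which only the
  values at \<open>1, \<dots>, n\<close> matter.\<close>

definition M :: "nat \<Rightarrow> nat \<Rightarrow> (nat \<Rightarrow> nat) \<Rightarrow> int \<Rightarrow> int" where
  "M p n m i = int (\<Sum>l = 1..n. m l) - i * (int p - 1)"

definition t_index :: "nat \<Rightarrow> nat \<Rightarrow> (nat \<Rightarrow> nat) \<Rightarrow> int" where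
  "t_index p n m = (THE t. M p n m (t + 1) < 0 \<and> 0 \<le> M p n m t)"

definition b_diff :: "nat \<Rightarrow> (nat \<Rightarrow> int) \<Rightarrow> nat \<Rightarrow> int" where
  "b_diff n a l = a l - a n"

text \<open>The tuples \<open>(j\<^sub>1, \<dots>, j\<^bsub>n-1\<^esub>)\<close> are extensional functions on \<open>{1..<n}\<close>; for \<open>n = 1\<close> there is
  exactly one of them, with sum \<open>0\<close>.\<close>

definition J_tuples :: "nat \<Rightarrow> (nat \<Rightarrow> nat) \<Rightarrow> int \<Rightarrow> (nat \<Rightarrow> nat) set" where
  "J_tuples n m s = {j \<in> (\<Pi>\<^sub>E l\<in>{1..<n}. {0..m l}). int (\<Sum>l\<in>{1..<n}. j l) = s}"

definition J :: "nat \<Rightarrow> nat \<Rightarrow> (nat \<Rightarrow> nat) \<Rightarrow> (nat \<Rightarrow> int) \<Rightarrow> int" where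
  "J p n m a = - (\<Sum>i = 1..t_index p n m. \<Sum>j\<in>J_tuples n m (M p n m i).
      (\<Prod>l\<in>{1..<n}. int (m l choose j l)) * (\<Prod>l\<in>{1..<n}. b_diff n a l ^ j l))"

end

theory Submission
  imports Defs "HOL-Number_Theory.Residue_Primitive_Roots"
begin

text \<open>
  Substitute \<open>x = a\<^sub>n + k\<close>. As \<open>k\<close> runs over a complete system of residues modulo \<open>p\<close>, so does \<open>x\<close>,
  and the sum becomes \<open>\<Sum>x. (b\<^sub>1 + x)^m\<^sub>1 \<cdots> (b\<^bsub>n-1\<^esub> + x)^m\<^bsub>n-1\<^esub> * x^m\<^sub>n\<close> (\<open>sum_residues_reindex\<close>). Expanding
  every factor by the binomial theorem (\<open>prod_shifted_powers_expand\<close>) turns this into a combination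
  of the power sums \<open>\<Sum>x. x^e\<close> with \<open>e = m\<^sub>1 + \<cdots> + m\<^sub>n - (j\<^sub>1 + \<cdots> + j\<^bsub>n-1\<^esub>)\<close>. Here \<open>e \<ge> m\<^sub>n > 0\<close>, so
  that such a power sum is \<open>-1\<close> or \<open>0\<close> modulo \<open>p\<close> according to whether \<open>p - 1\<close> divides \<open>e\<close>
  (\<open>power_sum_mod_prime\<close>). The surviving tuples are those with \<open>e = i * (p - 1)\<close> for some \<open>i \<ge> 1\<close>,
  that is \<open>j\<^sub>1 + \<cdots> + j\<^bsub>n-1\<^esub> = M\<^sub>i\<close>, and \<open>M\<^sub>i \<ge> 0\<close> forces \<open>i \<le> t\<close>: what remains is exactly \<open>J\<close>.

  The congruence with \<open>J\<close> thus holds in all three cases (\<open>shifted_power_product_sum_cong_J\<close>). If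
  \<open>m\<^sub>1 + \<cdots> + m\<^sub>n < p - 1\<close>, then \<open>t = 0\<close> and \<open>J\<close> is an empty sum. If all exponents are \<open>p - 1\<close>, then by
  Fermat's theorem the product is \<open>0\<close> when \<open>k\<close> is one of the \<open>n\<close> distinct residues \<open>-a\<^sub>i\<close>, and \<open>1\<close> for
  the other \<open>p - n\<close> values of \<open>k\<close>.
\<close>

section \<open>Sums over a complete system of residues\<close>

text \<open>
  A map that is injective modulo \<open>p\<close> permutes the finitely many residue classes. This serves both for
  the shift by \<open>a\<^sub>n\<close> and for the multiplication by a primitive root.
\<close>

lemma sum_residues_reindex:
  fixes f h :: "int \<Rightarrow> int" and p :: nat
  assumes "p > 0"
    and f: "\<And>x y. [x = y] (mod int p) \<Longrightarrow> [f x = f y] (mod int p)"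
    and h: "\<And>x y. [h x = h y] (mod int p) \<Longrightarrow> [x = y] (mod int p)"
  shows "[(\<Sum>k<p. f (h (int k))) = (\<Sum>k<p. f (int k))] (mod int p)"
proof -
  define \<sigma> where "\<sigma> = (\<lambda>k. nat (h (int k) mod int p))"
  have int_\<sigma>: "int (\<sigma> k) = h (int k) mod int p" for k
    using \<open>p > 0\<close> by (simp add: \<sigma>_def)
  have \<sigma>_less: "\<sigma> k < p" for k
    using int_\<sigma>[of k] \<open>p > 0\<close> by (metis of_nat_0_less_iff of_nat_less_iff pos_mod_bound)
  have inj: "inj_on \<sigma> {..<p}"
  proof (rule inj_onI)
    fix k l assume kl: "k \<in> {..<p}" "l \<in> {..<p}" "\<sigma> k = \<sigma> l"
    have "[h (int k) = h (int l)] (mod int p)"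
      using kl(3) int_\<sigma>[of k] int_\<sigma>[of l] by (simp add: cong_def)
    then have "[k = l] (mod p)"
      using h cong_int_iff by blast
    with kl show "k = l" by (simp add: cong_def)
  qed
  have "\<sigma> ` {..<p} = {..<p}"
    using inj \<sigma>_less by (intro endo_inj_surj) auto
  with inj have "bij_betw \<sigma> {..<p} {..<p}"
    by (simp add: bij_betw_def)
  then have "(\<Sum>k<p. f (int k)) = (\<Sum>k<p. f (int (\<sigma> k)))"
    by (rule sum.reindex_bij_betw[symmetric])
  moreover have "[(\<Sum>k<p. f (h (int k))) = (\<Sum>k<p. f (int (\<sigma> k)))] (mod int p)"
    by (intro cong_sum f) (simp add: int_\<sigma> cong_def)
  ultimately show ?thesis by simp
qed

lemma fermat_int:
  fixes x :: int
  assumes "prime p" and "\<not> int p dvd x"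
  shows "[x ^ (p - 1) = 1] (mod int p)"
proof -
  have "p > 0" using \<open>prime p\<close> by (rule prime_gt_0_nat)
  define y where "y = nat (x mod int p)"
  have y: "int y = x mod int p" using \<open>p > 0\<close> by (simp add: y_def)
  have "\<not> p dvd y"
    using assms(2) y by (metis dvd_mod_iff dvd_refl int_dvd_int_iff)
  then have "[int (y ^ (p - 1)) = int 1] (mod int p)"
    using fermat_theorem[OF \<open>prime p\<close>] cong_int_iff by blast
  then show ?thesis
    by (simp add: y cong_def power_mod)
qed

text \<open>
  If \<open>p - 1\<close> divides \<open>e\<close>, Fermat's theorem gives \<open>p - 1\<close> terms equal to \<open>1\<close>; the term \<open>k = 0\<close> is \<open>0\<close>
  because \<open>e > 0\<close>. Otherwise let \<open>g\<close> be a primitive root: replacing \<open>k\<close> by \<open>g * k\<close> permutes the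
  residues, so the sum is fixed under multiplication by \<open>g ^ e\<close>, which is not \<open>1\<close> modulo \<open>p\<close>.
\<close>

lemma power_sum_mod_prime:
  fixes p e :: nat
  assumes "prime p" and "e > 0"
  shows "[(\<Sum>k<p. int k ^ e) = (if p - 1 dvd e then - 1 else 0)] (mod int p)"
proof (cases "p - 1 dvd e")
  case True
  have "p > 1" using \<open>prime p\<close> by (rule prime_gt_1_nat)
  obtain c where e: "e = (p - 1) * c" using True by blast
  have "(\<Sum>k<p. int k ^ e) = (\<Sum>k\<in>{..<p} - {0}. int k ^ e)"
    using \<open>p > 1\<close> \<open>e > 0\<close> by (subst sum.remove[of _ 0]) auto
  also have "[\<dots> = (\<Sum>k\<in>{..<p} - {0}. 1)] (mod int p)"
  proof (rule cong_sum)
    fix k assume "k \<in> {..<p} - {0}"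
    then have "\<not> int p dvd int k" by (auto dest: dvd_imp_le)
    from cong_pow[OF fermat_int[OF \<open>prime p\<close> this], of c]
    show "[int k ^ e = 1] (mod int p)" by (simp add: e power_mult)
  qed
  also have "(\<Sum>k\<in>{..<p} - {0}. (1::int)) = int p - 1"
    using \<open>p > 1\<close> by simp
  also have "[int p - 1 = - 1] (mod int p)"
    by (simp add: cong_iff_dvd_diff)
  finally show ?thesis using True by simp
next
  case False
  have "p > 1" using \<open>prime p\<close> by (rule prime_gt_1_nat)
  obtain g where "residue_primroot p g"
    using prime_primitive_root_exists[of p] \<open>prime p\<close> \<open>p > 1\<close> by auto
  then have g: "coprime p g" "ord p g = p - 1"
    using \<open>prime p\<close> by (auto simp: residue_primroot_def totient_prime)
  have "\<not> [g ^ e = 1] (mod p)"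
    using False g by (metis ord_divides)
  then have "\<not> [int (g ^ e) = int 1] (mod int p)"
    by (simp only: cong_int_iff not_False_eq_True)
  then have ge: "\<not> int p dvd int g ^ e - 1"
    by (simp add: cong_iff_dvd_diff)
  have "[(\<Sum>k<p. (int g * int k) ^ e) = (\<Sum>k<p. int k ^ e)] (mod int p)"
  proof (rule sum_residues_reindex[where f = "\<lambda>x. x ^ e" and h = "\<lambda>x. int g * x"])
    show "[x = y] (mod int p)" if "[int g * x = int g * y] (mod int p)" for x y
      using that g(1) by (subst (asm) cong_mult_lcancel) (auto simp: coprime_commute)
  qed (use \<open>p > 1\<close> in \<open>auto intro: cong_pow\<close>)
  moreover have "(\<Sum>k<p. (int g * int k) ^ e) = int g ^ e * (\<Sum>k<p. int k ^ e)"
    by (simp add: power_mult_distrib sum_distrib_left)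
  ultimately have "int p dvd (int g ^ e - 1) * (\<Sum>k<p. int k ^ e)"
    by (simp add: cong_iff_dvd_diff left_diff_distrib)
  then have "int p dvd (\<Sum>k<p. int k ^ e)"
    using ge \<open>prime p\<close> prime_dvd_mult_iff[of "int p"] by auto
  then show ?thesis using False by (simp add: cong_0_iff)
qed

section \<open>Expansion of the product\<close>

lemma prod_shifted_powers_expand:
  fixes b :: "'i \<Rightarrow> 'a :: comm_ring_1" and m :: "'i \<Rightarrow> nat"
  assumes "finite A"
  shows "(\<Prod>l\<in>A. (b l + x) ^ m l) =
    (\<Sum>j\<in>(\<Pi>\<^sub>E l\<in>A. {0..m l}).
      (\<Prod>l\<in>A. of_nat (m l choose j l)) * (\<Prod>l\<in>A. b l ^ j l) * x ^ (sum m A - sum j A))"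
proof -
  have "(\<Prod>l\<in>A. (b l + x) ^ m l) =
      (\<Prod>l\<in>A. \<Sum>i\<in>{0..m l}. of_nat (m l choose i) * b l ^ i * x ^ (m l - i))"
    by (simp add: binomial_ring atMost_atLeast0)
  also have "\<dots> = (\<Sum>j\<in>(\<Pi>\<^sub>E l\<in>A. {0..m l}).
      \<Prod>l\<in>A. of_nat (m l choose j l) * b l ^ j l * x ^ (m l - j l))"
    using \<open>finite A\<close> by (intro prod_sum_PiE) auto
  also have "\<dots> = (\<Sum>j\<in>(\<Pi>\<^sub>E l\<in>A. {0..m l}).
      (\<Prod>l\<in>A. of_nat (m l choose j l)) * (\<Prod>l\<in>A. b l ^ j l) * x ^ (sum m A - sum j A))"
  proof (rule sum.cong[OF refl])
    fix j assume "j \<in> (\<Pi>\<^sub>E l\<in>A. {0..m l})"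
    then have "(\<Sum>l\<in>A. m l - j l) = sum m A - sum j A"
      by (intro sum_subtractf_nat) auto
    then show "(\<Prod>l\<in>A. of_nat (m l choose j l) * b l ^ j l * x ^ (m l - j l)) =
        (\<Prod>l\<in>A. of_nat (m l choose j l)) * (\<Prod>l\<in>A. b l ^ j l) * x ^ (sum m A - sum j A)"
      by (simp add: prod.distrib flip: power_sum)
  qed
  finally show ?thesis .
qed

section \<open>The index t and the tuples that survive\<close>

lemma t_index_eq_div:
  assumes "p > 1"
  shows "t_index p n m = int (\<Sum>l = 1..n. m l) div (int p - 1)"
  unfolding t_index_def M_def
proof (rule the_equality)
  let ?N = "int (\<Sum>l = 1..n. m l)" and ?q = "int p - 1"
  have q: "?q > 0" using assms by simp
  have "?N - ?N div ?q * ?q = ?N mod ?q" by (rule minus_div_mult_eq_mod)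
  moreover have "0 \<le> ?N mod ?q" "?N mod ?q < ?q" using q by simp_all
  moreover have "?N - (?N div ?q + 1) * ?q = ?N - ?N div ?q * ?q - ?q"
    by (simp only: distrib_right mult_1 diff_diff_eq)
  ultimately show "?N - (?N div ?q + 1) * ?q < 0 \<and> 0 \<le> ?N - ?N div ?q * ?q"
    by linarith
  fix t assume t: "?N - (t + 1) * ?q < 0 \<and> 0 \<le> ?N - t * ?q"
  show "t = ?N div ?q"
    by (rule int_div_pos_eq[symmetric, of _ _ _ "?N - t * ?q"])
      (use t in \<open>auto simp: algebra_simps\<close>)
qed

text \<open>
  The inner sums of \<open>J\<close> run over pairwise disjoint sets of tuples; together these are the tuples for
  which the exponent of \<open>x\<close> left over by the expansion is a multiple of \<open>p - 1\<close>. That exponent is at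
  least \<open>m n > 0\<close>, so the multiples start at \<open>i = 1\<close>; being at most \<open>m\<^sub>1 + \<cdots> + m\<^sub>n\<close>, they end at \<open>i = t\<close>.
\<close>

lemma J_eq_sum_divisible_exponent:
  assumes "p > 1" and "n \<ge> 1" and "m n > 0"
  shows "J p n m a = - (\<Sum>j\<in>{j \<in> (\<Pi>\<^sub>E l\<in>{1..<n}. {0..m l}).
        p - 1 dvd sum m {1..<n} - sum j {1..<n} + m n}.
      (\<Prod>l\<in>{1..<n}. int (m l choose j l)) * (\<Prod>l\<in>{1..<n}. b_diff n a l ^ j l))"
proof -
  let ?P = "\<Pi>\<^sub>E l\<in>{1..<n}. {0..m l}" and ?t = "t_index p n m"
  let ?e = "\<lambda>j. sum m {1..<n} - sum j {1..<n} + m n"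
  let ?T = "\<lambda>i. J_tuples n m (M p n m i)"
  have q: "int (p - 1) = int p - 1" "int p - 1 > 0" using \<open>p > 1\<close> by auto
  have total: "(\<Sum>l = 1..n. m l) = sum m {1..<n} + m n"
    using \<open>n \<ge> 1\<close> by (metis add.commute sum.last_plus)
  have exponent: "int (?e j) = int (\<Sum>l = 1..n. m l) - int (sum j {1..<n})" if "j \<in> ?P" for j
  proof -
    have "sum j {1..<n} \<le> sum m {1..<n}"
      using that by (intro sum_mono) (auto simp: PiE_iff)
    then show ?thesis by (simp only: total)
  qed
  have mem_T: "j \<in> ?T i \<longleftrightarrow> j \<in> ?P \<and> int (?e j) = i * (int p - 1)" for i j
    using exponent[of j] by (auto simp: J_tuples_def M_def)
  have finite_P: "finite ?P" by (intro finite_PiE) auto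
  \<comment> \<open>the index of the set containing \<open>j\<close> is the quotient of the exponent by \<open>p - 1\<close>\<close>
  have union: "(\<Union>i\<in>{1..?t}. ?T i) = {j \<in> ?P. p - 1 dvd ?e j}"
  proof (intro equalityI subsetI)
    fix j assume "j \<in> (\<Union>i\<in>{1..?t}. ?T i)"
    then obtain i where "j \<in> ?T i" by blast
    then have "j \<in> ?P" "int (p - 1) dvd int (?e j)"
      by (auto simp only: mem_T q dvd_triv_right)
    then show "j \<in> {j \<in> ?P. p - 1 dvd ?e j}"
      by (simp only: int_dvd_int_iff mem_Collect_eq simp_thms)
  next
    fix j assume "j \<in> {j \<in> ?P. p - 1 dvd ?e j}"
    then have j: "j \<in> ?P" "p - 1 dvd ?e j" by auto
    then obtain c where c: "?e j = (p - 1) * c" by blast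
    have "c \<ge> 1"
      using c \<open>m n > 0\<close> by (cases c) auto
    have ce: "int (?e j) = int c * (int p - 1)"
      by (simp only: c of_nat_mult q mult.commute)
    then have "int c * (int p - 1) \<le> int (\<Sum>l = 1..n. m l)"
      using exponent[OF j(1)] by linarith
    then have "int c \<le> ?t"
      using \<open>p > 1\<close> q(2)
      by (metis t_index_eq_div nonzero_mult_div_cancel_right order_less_irrefl zdiv_mono1)
    then show "j \<in> (\<Union>i\<in>{1..?t}. ?T i)"
      using j(1) ce \<open>c \<ge> 1\<close> mem_T by auto
  qed
  have "J p n m a = - (\<Sum>j\<in>(\<Union>i\<in>{1..?t}. ?T i).
      (\<Prod>l\<in>{1..<n}. int (m l choose j l)) * (\<Prod>l\<in>{1..<n}. b_diff n a l ^ j l))"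
    unfolding J_def
  proof (subst sum.UNION_disjoint)
    show "\<forall>i\<in>{1..?t}. finite (?T i)"
      using finite_P by (simp add: J_tuples_def)
    show "\<forall>i\<in>{1..?t}. \<forall>i'\<in>{1..?t}. i \<noteq> i' \<longrightarrow> ?T i \<inter> ?T i' = {}"
      using q(2) by (auto simp: mem_T)
  qed auto
  then show ?thesis by (simp only: union)
qed

section \<open>The congruence\<close>

theorem shifted_power_product_sum_cong_J:
  fixes a :: "nat \<Rightarrow> int"
  assumes "prime p" and "n \<ge> 1" and "m n > 0"
  shows "[(\<Sum>k<p. \<Prod>i = 1..n. (a i + int k) ^ m i) = J p n m a] (mod int p)"
proof -
  let ?P = "\<Pi>\<^sub>E l\<in>{1..<n}. {0..m l}"
  let ?e = "\<lambda>j. sum m {1..<n} - sum j {1..<n} + m n"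
  define c where "c = (\<lambda>j. (\<Prod>l\<in>{1..<n}. int (m l choose j l)) * (\<Prod>l\<in>{1..<n}. b_diff n a l ^ j l))"
  define f where "f = (\<lambda>x. (\<Prod>l\<in>{1..<n}. (b_diff n a l + x) ^ m l) * x ^ m n)"
  have "p > 1" using \<open>prime p\<close> by (rule prime_gt_1_nat)
  have finite_P: "finite ?P" by (intro finite_PiE) auto
  have f_expand: "f x = (\<Sum>j\<in>?P. c j * x ^ ?e j)" for x
    unfolding f_def c_def
    by (subst prod_shifted_powers_expand) (simp_all add: sum_distrib_right power_add mult.assoc)
  have "(\<Prod>i = 1..n. (a i + int k) ^ m i) = f (a n + int k)" for k
  proof -
    have "{1..n} = insert n {1..<n}" using \<open>n \<ge> 1\<close> by auto
    then show ?thesis by (simp add: f_def b_diff_def mult.commute)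
  qed
  then have "(\<Sum>k<p. \<Prod>i = 1..n. (a i + int k) ^ m i) = (\<Sum>k<p. f (a n + int k))"
    by simp
  also have "[\<dots> = (\<Sum>k<p. f (int k))] (mod int p)"
  proof (rule sum_residues_reindex[where h = "\<lambda>x. a n + x"])
    show "[f x = f y] (mod int p)" if "[x = y] (mod int p)" for x y
      unfolding f_def using that by (intro cong_mult cong_prod cong_pow cong_add cong_refl)
    show "[x = y] (mod int p)" if "[a n + x = a n + y] (mod int p)" for x y
      using that by (simp add: cong_add_lcancel)
  qed (use \<open>p > 1\<close> in simp)
  also have "(\<Sum>k<p. f (int k)) = (\<Sum>j\<in>?P. c j * (\<Sum>k<p. int k ^ ?e j))"
    unfolding f_expand sum_distrib_left by (rule sum.swap)
  also have "[\<dots> = (\<Sum>j\<in>?P. c j * (if p - 1 dvd ?e j then - 1 else 0))] (mod int p)"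
    using \<open>m n > 0\<close> by (intro cong_sum cong_mult cong_refl power_sum_mod_prime[OF \<open>prime p\<close>]) simp
  also have "(\<Sum>j\<in>?P. c j * (if p - 1 dvd ?e j then - 1 else 0)) =
      - (\<Sum>j\<in>{j \<in> ?P. p - 1 dvd ?e j}. c j)"
  proof -
    have "(\<Sum>j\<in>?P. c j * (if p - 1 dvd ?e j then - 1 else 0)) =
        (\<Sum>j\<in>?P. if p - 1 dvd ?e j then - c j else 0)"
      by (intro sum.cong) auto
    then show ?thesis
      using finite_P by (simp only: sum.inter_filter[symmetric] sum_negf)
  qed
  also have "\<dots> = J p n m a"
    unfolding c_def using J_eq_sum_divisible_exponent[of p n m a] \<open>p > 1\<close> assms by simp
  finally show ?thesis .
qed

text \<open>
  By Fermat's theorem every factor is \<open>0\<close> or \<open>1\<close> modulo \<open>p\<close>, so the sum counts the \<open>k\<close> that avoid all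
  the residues \<open>- a i\<close>. These residues are distinct, which leaves \<open>p - card A\<close> values of \<open>k\<close>.
\<close>

lemma shifted_fermat_product_sum:
  fixes a :: "nat \<Rightarrow> int"
  assumes "prime p" and "finite A"
    and distinct: "\<And>i j. i \<in> A \<Longrightarrow> j \<in> A \<Longrightarrow> [a i = a j] (mod int p) \<Longrightarrow> i = j"
  shows "[(\<Sum>k<p. \<Prod>i\<in>A. (a i + int k) ^ (p - 1)) = - int (card A)] (mod int p)"
proof -
  have "p > 1" using \<open>prime p\<close> by (rule prime_gt_1_nat)
  define r where "r = (\<lambda>i. nat ((- a i) mod int p))"
  have int_r: "int (r i) = (- a i) mod int p" for i
    using \<open>p > 1\<close> by (simp add: r_def)
  have r_less: "r i < p" for i
    using int_r[of i] \<open>p > 1\<close>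
    by (metis of_nat_0_less_iff of_nat_less_iff pos_mod_bound zero_less_one less_trans)
  have dvd_iff: "int p dvd a i + int k \<longleftrightarrow> k = r i" if "k < p" for i k
  proof -
    have "int p dvd a i + int k \<longleftrightarrow> [int k = - a i] (mod int p)"
      by (simp add: cong_iff_dvd_diff add.commute)
    also have "\<dots> \<longleftrightarrow> int k = int (r i)"
      using that by (simp add: cong_def int_r)
    finally show ?thesis by simp
  qed
  have inj: "inj_on r A"
  proof (rule inj_onI)
    fix i j assume ij: "i \<in> A" "j \<in> A" "r i = r j"
    then have "[- a i = - a j] (mod int p)"
      using int_r[of i] int_r[of j] by (simp add: cong_def)
    then have "[a i = a j] (mod int p)"
      by (simp add: cong_minus_minus_iff)
    with ij distinct show "i = j" by blast
  qed
  have roots: "r ` A \<subseteq> {..<p}" using r_less by auto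
  have "[(\<Sum>k<p. \<Prod>i\<in>A. (a i + int k) ^ (p - 1)) = (\<Sum>k<p. if k \<in> r ` A then 0 else 1)] (mod int p)"
  proof (rule cong_sum)
    fix k assume k: "k \<in> {..<p}"
    show "[(\<Prod>i\<in>A. (a i + int k) ^ (p - 1)) = (if k \<in> r ` A then 0 else 1)] (mod int p)"
    proof (cases "k \<in> r ` A")
      case True
      then obtain i where i: "i \<in> A" "k = r i" by blast
      then have "int p dvd a i + int k"
        using k dvd_iff by blast
      also have "\<dots> dvd (a i + int k) ^ (p - 1)"
        using \<open>p > 1\<close> by (intro dvd_power) simp
      finally have "int p dvd (\<Prod>i\<in>A. (a i + int k) ^ (p - 1))"
        using \<open>finite A\<close> i(1) by (meson dvd_prodI dvd_trans)
      then show ?thesis using True by (simp add: cong_0_iff)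
    next
      case False
      then have "[(\<Prod>i\<in>A. (a i + int k) ^ (p - 1)) = (\<Prod>i\<in>A. 1)] (mod int p)"
        using k dvd_iff by (intro cong_prod fermat_int[OF \<open>prime p\<close>]) auto
      then show ?thesis using False by simp
    qed
  qed
  also have "(\<Sum>k<p. if k \<in> r ` A then 0 else (1::int)) = int (card ({..<p} - r ` A))"
    by (simp add: sum.If_cases Diff_eq)
  also have "\<dots> = int p - int (card A)"
    using roots card_mono[OF _ roots]
    by (simp add: card_Diff_subset[OF finite_imageI[OF \<open>finite A\<close>]] card_image[OF inj] of_nat_diff)
  also have "[\<dots> = - int (card A)] (mod int p)"
    by (simp add: cong_iff_dvd_diff)
  finally show ?thesis .
qed

theorem theorem4p1:
  fixes p n :: nat and m :: "nat \<Rightarrow> nat" and a :: "nat \<Rightarrow> int"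
  assumes "prime p" and "n \<ge> 1"
    and "\<And>i. i \<in> {1..n} \<Longrightarrow> 1 \<le> m i \<and> m i \<le> p - 1"
    and "\<And>i. i \<in> {1..n} \<Longrightarrow> 0 \<le> a i \<and> a i \<le> int p - 1"
    and "\<And>i j. i \<in> {1..n} \<Longrightarrow> j \<in> {1..n} \<Longrightarrow> i \<noteq> j \<Longrightarrow> a i \<noteq> a j"
  shows "[(\<Sum>k = 0..p - 1. \<Prod>i = 1..n. (a i + int k) ^ m i) =
      (if (\<Sum>i = 1..n. m i) < p - 1 then 0
       else if \<forall>i\<in>{1..n}. m i = p - 1 then - int n
       else J p n m a)] (mod int p)"
proof -
  let ?S = "\<Sum>k<p. \<Prod>i = 1..n. (a i + int k) ^ m i"
  have "p > 1" using \<open>prime p\<close> by (rule prime_gt_1_nat)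
  then have range: "{0..p - 1} = {..<p}" by auto
  have S_J: "[?S = J p n m a] (mod int p)"
    using assms(3)[of n] \<open>n \<ge> 1\<close> by (intro shifted_power_product_sum_cong_J \<open>prime p\<close>) auto
  have "[?S = 0] (mod int p)" if "(\<Sum>i = 1..n. m i) < p - 1"
  proof -
    have "t_index p n m = 0"
      unfolding t_index_eq_div[OF \<open>p > 1\<close>] using that by (intro div_pos_pos_trivial) linarith+
    then have "J p n m a = 0" by (simp add: J_def)
    with S_J show ?thesis by (simp only:)
  qed
  moreover have "[?S = - int n] (mod int p)" if "\<forall>i\<in>{1..n}. m i = p - 1"
  proof -
    \<comment> \<open>the \<open>a i\<close> are their own least residues, so distinct values stay distinct modulo \<open>p\<close>\<close>
    have "i = j" if "i \<in> {1..n}" "j \<in> {1..n}" "[a i = a j] (mod int p)" for i j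
      using assms(4)[OF that(1)] assms(4)[OF that(2)] assms(5)[OF that(1,2)] that(3)
      by (auto simp: cong_def)
    then have "[(\<Sum>k<p. \<Prod>i\<in>{1..n}. (a i + int k) ^ (p - 1)) = - int (card {1..n})] (mod int p)"
      by (intro shifted_fermat_product_sum \<open>prime p\<close> finite_atLeastAtMost)
    then show ?thesis using that by simp
  qed
  ultimately show ?thesis
    unfolding range using S_J by (simp only: split: if_split) blast
qed

end
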